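(* Let $X$ be a real finite-dimensional Banach space and let $T:X\to X$ be a polynomial diffeomorphism with an asymptotically stable, hyperbolic fixed point at $0$, such that the complexified differential $T_{\mathbb C}'(0):X_{\mathbb C}\to X_{\mathbb C}$ is diagonalizable. Suppose there exist neighborhoods $U,V\subset X$ of $0$ and a topological conjugacy $\tau:U\to V$ from $T'(0)$ to $T$ with $\tau(0)=0$. Let $K\subset U$ be a compact neighborhood of $0$, let $L=\tau(K)\subset V$, let $\mathcal A_K\subset C_{\mathbb C}(K)$ be the principle algebra on $K$, and set $$\mathcal A_L=\mathcal A_K\circ\tau^{-1}:=\{f\circ\tau^{-1}\in C_{\mathbb C}(L) : f\in\mathcal A_K\}.$$ Then the uniform closure of $\mathcal A_L$ is (a) $C_{\mathbb C}(L)$, if the constant functions are appended to $\mathcal A_K$; (b) the maximal ideal $I_0=\{f\in C_{\mathbb C}(L) : f(0)=0\}$, otherwise.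
   Context: For a compact set $M$, $C_{\mathbb C}(M)$ is the space of complex-valued continuous functions on $M$ with the uniform norm. A topological conjugacy $\tau:U\to V$ from $T'(0)$ to $T$ is a homeomorphism with $T'(0)=\tau^{-1}\circ T\circ\tau$ on $U$. $X_{\mathbb C}=\{x+iy : x,y\in X\}$ is the complexification of $X$ (so $X\subset X_{\mathbb C}$), and $T'_{\mathbb C}(0)$ is the complex-linear extension to $X_{\mathbb C}$ of the differential $T'(0):X\to X$. Let $n=\dim X$ and let $\{e_1,\dots,e_n\}$ be a basis of $X_{\mathbb C}$ of eigenvectors of $T'_{\mathbb C}(0)$, chosen so that each eigenvector is either real (in $X$) or occurs together with its complex conjugate. The principle eigenfunctions are the dual basis $\phi_1,\dots,\phi_n\in X_{\mathbb C}^*$, $\phi_k(e_j)=\delta_{j,k}$. The principle algebra $\mathcal A_K$ is the complex algebra generated by $\phi_1|_K,\dots,\phi_n|_K$, i.e. the set of all finite complex linear combinations of products of one or more of these functions (pointwise multiplication); without appending the constants it is not assumed to contain nonzero constants. *)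

theory Defs
  imports "HOL-Analysis.Analysis" "HOL-Algebra.Ideal"
begin

section \<open>Complexification\<close>

text \<open>The pair \<open>(x, y)\<close> stands for \<open>x + iy\<close>; a real vector \<open>x\<close> is identified with \<open>(x, 0)\<close>.\<close>

type_synonym 'a complexification = "'a \<times> 'a"

definition cscale :: "complex \<Rightarrow> 'a::real_vector complexification \<Rightarrow> 'a complexification" where
  "cscale c v = (Re c *\<^sub>R fst v - Im c *\<^sub>R snd v, Re c *\<^sub>R snd v + Im c *\<^sub>R fst v)"

interpretation cx: vector_space "cscale :: complex \<Rightarrow> 'a::real_vector complexification \<Rightarrow> _"
  by unfold_locales (auto simp: cscale_def prod_eq_iff algebra_simps)

definition conjugate :: "'a::real_vector complexification \<Rightarrow> 'a complexification" where
  "conjugate v = (fst v, - snd v)"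

definition complexify :: "('a \<Rightarrow> 'a) \<Rightarrow> 'a complexification \<Rightarrow> 'a complexification" where
  "complexify A = map_prod A A"

lemma complexify_linear:
  assumes "linear A"
  shows "Vector_Spaces.linear cscale cscale (complexify A)"
proof -
  interpret A: linear A by fact
  show ?thesis
    by unfold_locales
      (auto simp: complexify_def cscale_def A.add A.diff A.scale)
qed

definition eigenpair :: "('a::real_vector complexification \<Rightarrow> 'a complexification) \<Rightarrow> complex \<Rightarrow>
    'a complexification \<Rightarrow> bool" where
  "eigenpair F c v \<longleftrightarrow> v \<noteq> 0 \<and> F v = cscale c v"

definition diagonalizable :: "('a::real_vector complexification \<Rightarrow> 'a complexification) \<Rightarrow> bool" where
  "diagonalizable F \<longleftrightarrow>
     (\<exists>B. cx.independent B \<and> cx.span B = UNIV \<and> (\<forall>v\<in>B. \<exists>c. eigenpair F c v))"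

definition conj_eigenbasis :: "('a::real_vector complexification \<Rightarrow> 'a complexification) \<Rightarrow> nat \<Rightarrow>
    (nat \<Rightarrow> 'a complexification) \<Rightarrow> bool" where
  "conj_eigenbasis F n e \<longleftrightarrow>
     inj_on e {1..n} \<and> cx.independent (e ` {1..n}) \<and> cx.span (e ` {1..n}) = UNIV \<and>
     (\<forall>k\<in>{1..n}. \<exists>c. eigenpair F c (e k)) \<and>
     (\<forall>k\<in>{1..n}. snd (e k) = 0 \<or> (\<exists>j\<in>{1..n}. e j = conjugate (e k)))"

definition dual_basis :: "nat \<Rightarrow> (nat \<Rightarrow> 'a::real_vector complexification) \<Rightarrow>
    (nat \<Rightarrow> 'a complexification \<Rightarrow> complex) \<Rightarrow> bool" where
  "dual_basis n e \<phi> \<longleftrightarrow>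
     (\<forall>k\<in>{1..n}. Vector_Spaces.linear cscale (*) (\<phi> k) \<and>
       (\<forall>j\<in>{1..n}. \<phi> k (e j) = (if j = k then 1 else 0)))"


section \<open>Dynamics\<close>

definition C1_map :: "('a::real_normed_vector \<Rightarrow> 'a) \<Rightarrow> bool" where
  "C1_map f \<longleftrightarrow>
     (\<exists>f' :: 'a \<Rightarrow> 'a \<Rightarrow>\<^sub>L 'a. (\<forall>x. (f has_derivative blinfun_apply (f' x)) (at x)) \<and>
        continuous_on UNIV f')"

text \<open>For a polynomial map, a \<open>C\<^sup>1\<close> inverse is automatically smooth (inverse function theorem),
  so the order of differentiability is immaterial. The inverse need not be polynomial.\<close>

definition diffeomorphism :: "('a::real_normed_vector \<Rightarrow> 'a) \<Rightarrow> bool" where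
  "diffeomorphism f \<longleftrightarrow> bij f \<and> C1_map f \<and> C1_map (inv_into UNIV f)"

definition asymptotically_stable_fixed_point :: "('a::metric_space \<Rightarrow> 'a) \<Rightarrow> 'a \<Rightarrow> bool" where
  "asymptotically_stable_fixed_point f p \<longleftrightarrow>
     f p = p \<and>
     (\<forall>\<epsilon>>0. \<exists>\<delta>>0. \<forall>x. dist x p < \<delta> \<longrightarrow> (\<forall>n. dist ((f ^^ n) x) p < \<epsilon>)) \<and>
     (\<exists>\<delta>>0. \<forall>x. dist x p < \<delta> \<longrightarrow> (\<lambda>n. (f ^^ n) x) \<longlonglongrightarrow> p)"

text \<open>In finite dimension the spectrum of the complexified differential is its set of
  eigenvalues.\<close>

definition hyperbolic_fixed_point :: "('a::real_normed_vector \<Rightarrow> 'a) \<Rightarrow> 'a \<Rightarrow> bool" where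
  "hyperbolic_fixed_point f p \<longleftrightarrow>
     f p = p \<and>
     (\<forall>c v. eigenpair (complexify (frechet_derivative f (at p))) c v \<longrightarrow> cmod c \<noteq> 1)"

text \<open>\<open>S = \<tau>\<^sup>-\<^sup>1 \<circ> T \<circ> \<tau>\<close> on \<open>U\<close>; for the right-hand side to be defined, \<open>T\<close> has to map
  \<open>\<tau> x\<close> into the domain \<open>V\<close> of \<open>\<tau>\<^sup>-\<^sup>1\<close>.\<close>

definition topological_conjugacy :: "'a set \<Rightarrow> 'a set \<Rightarrow> ('a \<Rightarrow> 'a) \<Rightarrow>
    ('a::topological_space \<Rightarrow> 'a) \<Rightarrow> ('a \<Rightarrow> 'a) \<Rightarrow> bool" where
  "topological_conjugacy U V \<tau> S T \<longleftrightarrow>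
     homeomorphism U V \<tau> (inv_into U \<tau>) \<and>
     (\<forall>x\<in>U. T (\<tau> x) \<in> V \<and> S x = inv_into U \<tau> (T (\<tau> x)))"


section \<open>Algebras of continuous functions\<close>

text \<open>A function on \<open>M\<close> is represented by its extensional version, which is
  \<^const>\<open>undefined\<close> outside \<open>M\<close>.\<close>

definition CC :: "'a::topological_space set \<Rightarrow> ('a \<Rightarrow> complex) metric" where
  "CC M = cfunspace (top_of_set M) euclidean_metric"

lemma mspace_CC:
  assumes "compact M"
  shows "mspace (CC M) = {f. continuous_on M f \<and> f \<in> extensional M}"
  using assms
  by (auto simp: CC_def intro: compact_imp_bounded compact_continuous_image)

definition uniform_closure :: "'a::topological_space set \<Rightarrow> ('a \<Rightarrow> complex) set \<Rightarrow>
    ('a \<Rightarrow> complex) set" where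
  "uniform_closure M S = mtopology_of (CC M) closure_of S"

text \<open>Closed under linear combinations and products, but not containing nonzero constants
  unless they are generated.\<close>

inductive_set generated_algebra :: "'a set \<Rightarrow> ('a \<Rightarrow> complex) set \<Rightarrow> ('a \<Rightarrow> complex) set"
  for M :: "'a set" and G :: "('a \<Rightarrow> complex) set" where
  generator: "g \<in> G \<Longrightarrow> restrict g M \<in> generated_algebra M G"
| zero: "(\<lambda>x\<in>M. 0) \<in> generated_algebra M G"
| add: "\<lbrakk>f \<in> generated_algebra M G; g \<in> generated_algebra M G\<rbrakk> \<Longrightarrow>
    (\<lambda>x\<in>M. f x + g x) \<in> generated_algebra M G"
| scale: "f \<in> generated_algebra M G \<Longrightarrow> (\<lambda>x\<in>M. c * f x) \<in> generated_algebra M G"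
| mult: "\<lbrakk>f \<in> generated_algebra M G; g \<in> generated_algebra M G\<rbrakk> \<Longrightarrow>
    (\<lambda>x\<in>M. f x * g x) \<in> generated_algebra M G"

definition principle_algebra :: "nat \<Rightarrow> (nat \<Rightarrow> 'a::real_vector complexification \<Rightarrow> complex) \<Rightarrow>
    'a set \<Rightarrow> ('a \<Rightarrow> complex) set" where
  "principle_algebra n \<phi> K = generated_algebra K ((\<lambda>k x. \<phi> k (x, 0)) ` {1..n})"

definition append_constants :: "'a set \<Rightarrow> ('a \<Rightarrow> complex) set \<Rightarrow> ('a \<Rightarrow> complex) set" where
  "append_constants M A = generated_algebra M (A \<union> {\<lambda>x. c | c. True})"

definition transport :: "'a set \<Rightarrow> ('a \<Rightarrow> 'a) \<Rightarrow> 'a set \<Rightarrow> ('a \<Rightarrow> complex) set \<Rightarrow>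
    ('a \<Rightarrow> complex) set" where
  "transport U \<tau> K A = (\<lambda>f. restrict (f \<circ> inv_into U \<tau>) (\<tau> ` K)) ` A"

definition CC_ring :: "'a::topological_space set \<Rightarrow> ('a \<Rightarrow> complex) ring" where
  "CC_ring M = \<lparr>carrier = mspace (CC M), mult = (\<lambda>f g. \<lambda>x\<in>M. f x * g x), one = (\<lambda>x\<in>M. 1),
     zero = (\<lambda>x\<in>M. 0), add = (\<lambda>f g. \<lambda>x\<in>M. f x + g x)\<rparr>"

definition vanishing_ideal :: "'a::topological_space set \<Rightarrow> 'a \<Rightarrow> ('a \<Rightarrow> complex) set" where
  "vanishing_ideal M p = {f \<in> mspace (CC M). f p = 0}"

end

(* The eigenbasis is closed under conjugation, hence so are the restrictions of the dual basis to
   the real vectors; they are continuous, separate points and vanish only at the origin. All of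
   this survives composition with the inverse of the conjugacy, so the complex Stone-Weierstrass
   theorem gives (a). For (b), a function vanishing at 0 is approximated with constants allowed;
   the constant term of the approximation is small because everything else vanishes at 0, so it
   can be dropped. *)
theory Submission
  imports Defs
begin

text \<open>Finite dimension is given as a finite spanning set of a normed space, without inner
  product or preferred basis. Continuity of the eigenfunctions therefore rests on the equivalence of
  norms, which compactness of a sphere of coordinate functions provides. The conditions of
  Stone-Weierstrass are placed on a generating set rather than on the algebra, because the two parts
  generate differently: in (b) the generators are the \<open>\<phi> k\<close>, while in (a) the
  constants join the finished algebra \<open>A\<^sub>K\<close>, all of whose members then count as
  generators. That the closure in (b) is a maximal ideal is a separate algebraic fact about the ring
  of continuous functions.\<close>

section \<open>Linear maps on finite-dimensional normed spaces\<close>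

text \<open>The norm is a continuous function of the coordinates, and by independence it is positive
  at its minimum over the compact sup-norm sphere. Homogeneity carries the bound to all coordinates,
  with the reciprocal of that minimum as constant. Coordinates are functions on the whole type, so
  compactness is that of a product of intervals.\<close>

lemma coordinates_bounded:
  fixes B :: "'a::real_normed_vector set"
  assumes fin: "finite B" and ind: "independent B"
  obtains C where "\<And>c b. b \<in> B \<Longrightarrow> \<bar>c b\<bar> \<le> C * norm (\<Sum>b\<in>B. c b *\<^sub>R b)"
proof (cases "B = {}")
  case True
  then show thesis using that by blast
next
  case False
  define N where "N c = norm (\<Sum>b\<in>B. c b *\<^sub>R b)" for c :: "'a \<Rightarrow> real"
  \<comment> \<open>the coordinate sphere for the sup norm; coordinates outside \<open>B\<close> play no role\<close>
  define S :: "('a \<Rightarrow> real) set"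
    where "S = (\<Pi>\<^sub>E b\<in>UNIV. {-1..1}) \<inter> (\<Union>b\<in>B. (\<lambda>c. \<bar>c b\<bar>) -` {1})"
  have "compact (\<Pi>\<^sub>E b\<in>(UNIV::'a set). {-1..1::real})"
    using compactin_PiE[of "\<lambda>_. euclideanreal" "UNIV::'a set" "\<lambda>_. {-1..1}"]
    by (simp add: euclidean_product_topology)
  moreover have "closed ((\<lambda>c::'a \<Rightarrow> real. \<bar>c b\<bar>) -` {1})" for b
    by (intro closed_vimage closed_singleton continuous_on_rabs continuous_on_product_coordinates)
  ultimately have "compact S"
    unfolding S_def using fin by (intro compact_Int_closed closed_UN) auto
  moreover have "(\<lambda>_. 1) \<in> S"
    using False by (auto simp: S_def)
  moreover have "continuous_on S N"
    unfolding N_def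
    by (intro continuous_intros continuous_on_subset[OF continuous_on_product_coordinates]) auto
  ultimately obtain c0 where c0: "c0 \<in> S" "\<And>c. c \<in> S \<Longrightarrow> N c0 \<le> N c"
    using continuous_attains_inf[of S N] by blast
  from c0(1) obtain b1 where b1: "b1 \<in> B" "c0 b1 \<noteq> 0"
    unfolding S_def by force
  then have pos: "N c0 > 0"
    using ind independentD[OF ind fin order_refl, of c0 b1]
    by (auto simp: N_def)
  show thesis
  proof (rule that[of "1 / N c0"])
    fix c :: "'a \<Rightarrow> real" and b assume b: "b \<in> B"
    define m where "m = Max ((\<lambda>b. \<bar>c b\<bar>) ` B)"
    have m: "\<bar>c b\<bar> \<le> m" if "b \<in> B" for b
      using that fin by (simp add: m_def)
    have "m \<in> (\<lambda>b. \<bar>c b\<bar>) ` B"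
      unfolding m_def using fin False by (intro Max_in) auto
    then obtain b0 where b0: "b0 \<in> B" "m = \<bar>c b0\<bar>" by blast
    have "m * N c0 \<le> N c"
    proof (cases "m = 0")
      case False
      then have mp: "m > 0" using b0 by simp
      \<comment> \<open>Outside \<open>B\<close> the quotient \<open>c x / m\<close> may exceed 1;
        the value 0 keeps \<open>c'\<close> in the cube.\<close>
      define c' where "c' x = (if x \<in> B then c x / m else 0)" for x
      have "\<bar>c' x\<bar> \<le> 1" for x
        using m[of x] mp by (simp add: c'_def)
      moreover have "\<bar>c' b0\<bar> = 1"
        using b0 mp by (simp add: c'_def)
      ultimately have "c' \<in> S"
        using b0(1) by (auto simp: S_def abs_le_iff PiE_iff neg_le_iff_le minus_le_iff)
      then have "N c0 \<le> N c'" by (rule c0)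
      moreover have "N c = m * N c'"
      proof -
        have "(\<Sum>b\<in>B. c b *\<^sub>R b) = m *\<^sub>R (\<Sum>b\<in>B. c' b *\<^sub>R b)"
          unfolding scaleR_sum_right using mp by (intro sum.cong) (auto simp: c'_def)
        then show ?thesis using mp by (simp add: N_def)
      qed
      ultimately show ?thesis using mp by simp
    qed (simp add: N_def)
    moreover have "\<bar>c b\<bar> * N c0 \<le> m * N c0"
      using m[OF b] pos by (simp add: mult_right_mono)
    ultimately have "\<bar>c b\<bar> \<le> N c / N c0"
      unfolding pos_le_divide_eq[OF pos] by linarith
    then show "\<bar>c b\<bar> \<le> 1 / N c0 * norm (\<Sum>b\<in>B. c b *\<^sub>R b)"
      by (simp add: N_def)
  qed
qed

text \<open>The spanning set may be dependent, so it is thinned out to a basis before the coordinate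
  bound applies; the images of the basis vectors then bound the map.\<close>

lemma linear_finite_dim_imp_bounded_linear:
  fixes f :: "'a::real_normed_vector \<Rightarrow> 'b::real_normed_vector"
  assumes "finite B" "span B = (UNIV :: 'a set)" and "linear f"
  shows "bounded_linear f"
proof -
  obtain B' where B': "B' \<subseteq> B" "independent B'" "span B' = (UNIV :: 'a set)"
    using maximal_independent_subset[of B] assms(2)
    by (metis span_eq subset_UNIV)
  then have fin: "finite B'" using assms(1) finite_subset by blast
  obtain C where C: "\<And>c b. b \<in> B' \<Longrightarrow> \<bar>c b\<bar> \<le> C * norm (\<Sum>b\<in>B'. c b *\<^sub>R b)"
    using coordinates_bounded[OF fin B'(2)] by blast
  interpret f: linear f by fact
  have "norm (f x) \<le> norm x * (C * (\<Sum>b\<in>B'. norm (f b)))" for x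
  proof -
    have "x \<in> span B'" using B' by simp
    then obtain c where c: "x = (\<Sum>b\<in>B'. c b *\<^sub>R b)"
      unfolding span_finite[OF fin] by blast
    have "norm (f x) \<le> (\<Sum>b\<in>B'. \<bar>c b\<bar> * norm (f b))"
      unfolding c f.sum f.scale by (rule order_trans[OF norm_sum]) simp
    also have "\<dots> \<le> (\<Sum>b\<in>B'. (C * norm x) * norm (f b))"
      unfolding c by (intro sum_mono mult_right_mono C) auto
    finally show ?thesis by (simp add: sum_distrib_left sum_distrib_right algebra_simps)
  qed
  then show ?thesis
    by (intro bounded_linear_intro[where K = "C * (\<Sum>b\<in>B'. norm (f b))"]) (auto simp: f.add f.scale)
qed

section \<open>Uniform closure and generated algebras\<close>

lemma continuous_on_restrict_iff [simp]:
  "continuous_on M (restrict f M) \<longleftrightarrow> continuous_on M f"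
  by (rule continuous_on_cong) auto

text \<open>Reduces closure to pointwise estimates. Closed balls fit because strict pointwise bounds
  give only a non-strict bound on the supremum; the converse direction halves the radius to regain
  strictness.\<close>

lemma uniform_closure_eq:
  assumes M: "compact M" and S: "S \<subseteq> mspace (CC M)"
  shows "uniform_closure M S =
    {f \<in> mspace (CC M). \<forall>r>0. \<exists>g\<in>S. \<forall>x\<in>M. cmod (f x - g x) < r}"
proof -
  interpret Metric_space "mspace (CC M)" "mdist (CC M)"
    by (rule Metric_space_mspace_mdist)
  have le: "mdist (CC M) f g \<le> r"
    if "\<forall>x\<in>M. cmod (f x - g x) < r" "r > 0" for f g r
    using that mdist_cfunspace_le[of r "top_of_set M" euclidean_metric f g]
    by (force simp: CC_def dist_norm)
  have lt: "cmod (f x - g x) < r"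
    if "f \<in> mspace (CC M)" "g \<in> mspace (CC M)" "mdist (CC M) f g \<le> r/2" "r > 0" "x \<in> M" for f g r x
    using mdist_cfunspace_imp_mdist_le[of f "top_of_set M" euclidean_metric g "r/2" x] that
    by (simp add: CC_def dist_norm)
  have "uniform_closure M S = {f \<in> mspace (CC M). \<forall>r>0. \<exists>g\<in>S. g \<in> mcball f r}"
    unfolding uniform_closure_def mtopology_of_def by (rule metric_closure_of_alt)
  also have "\<dots> = {f \<in> mspace (CC M). \<forall>r>0. \<exists>g\<in>S. \<forall>x\<in>M. cmod (f x - g x) < r}"
  proof (rule Collect_cong, intro conj_cong refl iffI allI impI)
    fix f and r :: real
    assume f: "f \<in> mspace (CC M)" and r: "r > 0"
    { assume "\<forall>r>0. \<exists>g\<in>S. g \<in> mcball f r"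
      then have "\<exists>g\<in>S. g \<in> mcball f (r/2)"
        using r half_gt_zero by blast
      then show "\<exists>g\<in>S. \<forall>x\<in>M. cmod (f x - g x) < r"
        using lt[OF f] r by (auto simp: in_mcball) }
    { assume "\<forall>r>0. \<exists>g\<in>S. \<forall>x\<in>M. cmod (f x - g x) < r"
      then show "\<exists>g\<in>S. g \<in> mcball f r"
        using le r f S by (meson in_mcball subsetD) }
  qed
  finally show ?thesis .
qed

text \<open>Members are extensional, hence determined by their values on \<open>M\<close>. This
  removes the nested restrictions that the introduction rules produce.\<close>

lemma generated_algebra_cong:
  assumes "f \<in> generated_algebra M G" "\<And>x. x \<in> M \<Longrightarrow> g x = f x"
  shows "restrict g M \<in> generated_algebra M G"
proof -
  have "f \<in> extensional M"
    using assms(1) by induction (rule restrict_extensional)+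
  then have "restrict g M = f"
    using assms(2) by (intro extensionalityI[of _ M]) auto
  then show ?thesis using assms(1) by simp
qed

lemma generated_algebra_subset_CC:
  assumes "compact M" "\<And>g. g \<in> G \<Longrightarrow> continuous_on M g"
  shows "generated_algebra M G \<subseteq> mspace (CC M)"
proof
  fix f assume "f \<in> generated_algebra M G"
  then have "continuous_on M f \<and> f \<in> extensional M"
    by induction (intro conjI restrict_extensional; simp add: assms continuous_intros)+
  then show "f \<in> mspace (CC M)"
    by (simp add: mspace_CC assms(1))
qed

text \<open>Conjugation respects sums and products and turns a scalar \<open>c\<close> into
  \<open>cnj c\<close>, so closure under it passes from the generators to the algebra.\<close>

lemma generated_algebra_cnj:
  assumes "\<And>g. g \<in> G \<Longrightarrow> \<exists>h\<in>G. \<forall>x\<in>M. h x = cnj (g x)"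
    and "f \<in> generated_algebra M G"
  shows "(\<lambda>x\<in>M. cnj (f x)) \<in> generated_algebra M G"
  using assms(2)
proof induction
  case (generator g)
  then obtain h where "h \<in> G" "\<forall>x\<in>M. h x = cnj (g x)" using assms(1) by blast
  then show ?case
    by (intro generated_algebra_cong[OF generated_algebra.generator[of h]]) auto
next
  case zero
  show ?case by (rule generated_algebra_cong[OF generated_algebra.zero]) simp
next
  case (add f g)
  show ?case by (rule generated_algebra_cong[OF generated_algebra.add[OF add.IH]]) simp
next
  case (scale f c)
  show ?case
    by (rule generated_algebra_cong[OF generated_algebra.scale[OF scale.IH, of "cnj c"]]) simp
next
  case (mult f g)
  show ?case by (rule generated_algebra_cong[OF generated_algebra.mult[OF mult.IH]]) simp
qed

lemma generated_algebra_append_constants: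
  assumes "f \<in> generated_algebra M (G \<union> {\<lambda>x. c | c. True})"
  shows "\<exists>h c. h \<in> generated_algebra M G \<and> f = (\<lambda>x\<in>M. h x + c)"
  using assms
proof induction
  case (generator g)
  then consider "g \<in> G" | c where "g = (\<lambda>x. c)" by blast
  then show ?case
  proof cases
    case 1
    show ?thesis
    proof (intro exI conjI)
      show "restrict g M \<in> generated_algebra M G"
        using 1 by (rule generated_algebra.generator)
      show "restrict g M = (\<lambda>x\<in>M. restrict g M x + 0)"
        by (rule ext) simp
    qed
  next
    case 2
    show ?thesis
    proof (intro exI conjI)
      show "(\<lambda>x\<in>M. 0) \<in> generated_algebra M G"
        by (rule generated_algebra.zero)
      show "restrict g M = (\<lambda>x\<in>M. (\<lambda>x\<in>M. 0) x + c)"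
        using 2 by (intro ext) simp
    qed
  qed
next
  case zero
  show ?case
  proof (intro exI conjI)
    show "(\<lambda>x\<in>M. 0) \<in> generated_algebra M G"
      by (rule generated_algebra.zero)
    show "(\<lambda>x\<in>M. 0) = (\<lambda>x\<in>M. (\<lambda>x\<in>M. 0) x + (0::complex))"
      by (intro ext) simp
  qed
next
  case (add f g)
  then obtain h c h' c' where *: "h \<in> generated_algebra M G" "f = (\<lambda>x\<in>M. h x + c)"
    "h' \<in> generated_algebra M G" "g = (\<lambda>x\<in>M. h' x + c')" by blast
  show ?case
    by (intro exI[of _ "\<lambda>x\<in>M. h x + h' x"] exI[of _ "c + c'"] conjI generated_algebra.add *)
      (auto simp: *)
next
  case (scale f d)
  then obtain h c where *: "h \<in> generated_algebra M G" "f = (\<lambda>x\<in>M. h x + c)" by blast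
  show ?case
    by (intro exI[of _ "\<lambda>x\<in>M. d * h x"] exI[of _ "d * c"] conjI generated_algebra.scale *)
      (auto simp: * algebra_simps)
next
  case (mult f g)
  then obtain h c h' c' where *: "h \<in> generated_algebra M G" "f = (\<lambda>x\<in>M. h x + c)"
    "h' \<in> generated_algebra M G" "g = (\<lambda>x\<in>M. h' x + c')" by blast
  \<comment> \<open>In the expansion of \<open>(h + c) * (h' + c')\<close> the other three terms
    stay in the algebra, and \<open>c * c'\<close> is the new constant.\<close>
  have "(\<lambda>x\<in>M. (\<lambda>x\<in>M. h x * h' x) x + (\<lambda>x\<in>M. (\<lambda>x\<in>M. c' * h x) x + (\<lambda>x\<in>M. c * h' x) x) x)
      \<in> generated_algebra M G"
    by (intro generated_algebra.add generated_algebra.scale generated_algebra.mult *)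
  then show ?case
    by (intro exI conjI) (auto simp: * algebra_simps)
qed

section \<open>Complex Stone-Weierstrass theorems\<close>

text \<open>Reduction to the real theorem. Closure under conjugation puts
  \<open>(g + cnj g) / 2\<close>, the real part of \<open>g\<close>, into the algebra, so the
  real-valued members still separate points; real and imaginary parts are then approximated
  separately.\<close>

lemma Stone_Weierstrass_complex:
  fixes M :: "'a::t2_space set"
  assumes M: "compact M" and cont: "\<And>g. g \<in> G \<Longrightarrow> continuous_on M g"
    and cnj: "\<And>g. g \<in> G \<Longrightarrow> \<exists>h\<in>G. \<forall>x\<in>M. h x = cnj (g x)"
    and sep: "\<And>x y. \<lbrakk>x \<in> M; y \<in> M; x \<noteq> y\<rbrakk> \<Longrightarrow> \<exists>g\<in>G. g x \<noteq> g y"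
  shows "uniform_closure M (generated_algebra M (G \<union> {\<lambda>x. c | c. True})) = mspace (CC M)"
proof -
  define H where "H = G \<union> {\<lambda>x. c | c. True}"
  define A where "A = generated_algebra M H"
  \<comment> \<open>The real theorem speaks of total functions, so \<open>R\<close> holds
    unrestricted ones and tests membership after restriction to \<open>M\<close>.\<close>
  define R where "R = {f :: 'a \<Rightarrow> real. (\<lambda>x\<in>M. complex_of_real (f x)) \<in> A}"
  have contH: "continuous_on M h" if "h \<in> H" for h
    using that cont by (auto simp: H_def)
  have cnjH: "\<exists>h\<in>H. \<forall>x\<in>M. h x = cnj (g x)" if "g \<in> H" for g
    using that cnj by (fastforce simp: H_def)
  have A: "A \<subseteq> mspace (CC M)"
    unfolding A_def by (rule generated_algebra_subset_CC[OF M contH])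
  have Re: "(\<lambda>x. Re (g x)) \<in> R" if "g \<in> A" for g
  proof -
    have "(\<lambda>x\<in>M. 1/2 * (\<lambda>x\<in>M. g x + (\<lambda>x\<in>M. cnj (g x)) x) x) \<in> A"
      using that unfolding A_def
      by (intro generated_algebra.scale generated_algebra.add generated_algebra_cnj cnjH)
    then show ?thesis unfolding R_def A_def
      by (auto simp: complex_add_cnj elim!: generated_algebra_cong)
  qed
  have Im: "(\<lambda>x. Im (g x)) \<in> R" if "g \<in> A" for g
  proof -
    \<comment> \<open>The imaginary part of \<open>g\<close> is the real part of
      \<open>- \<i> * g\<close>.\<close>
    have "(\<lambda>x\<in>M. - \<i> * g x) \<in> A"
      using that unfolding A_def by (rule generated_algebra.scale)
    from Re[OF this] show ?thesis unfolding R_def A_def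
      by (auto elim!: generated_algebra_cong)
  qed
  interpret function_ring_on R M
  proof
    show "compact M" by fact
    show "continuous_on M f" if "f \<in> R" for f
    proof -
      have "(\<lambda>x\<in>M. complex_of_real (f x)) \<in> mspace (CC M)"
        using that A by (auto simp: R_def)
      then have "continuous_on M (\<lambda>x. Re ((\<lambda>x\<in>M. complex_of_real (f x)) x))"
        by (intro continuous_on_Re) (simp add: mspace_CC M)
      then show ?thesis by (simp)
    qed
    show "(\<lambda>x. f x + g x) \<in> R" if "f \<in> R" "g \<in> R" for f g
    proof -
      have "(\<lambda>x\<in>M. (\<lambda>x\<in>M. complex_of_real (f x)) x + (\<lambda>x\<in>M. complex_of_real (g x)) x) \<in> A"
        using that unfolding R_def A_def mem_Collect_eq by (rule generated_algebra.add)
      then show ?thesis unfolding R_def A_def by (auto elim!: generated_algebra_cong)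
    qed
    show "(\<lambda>x. f x * g x) \<in> R" if "f \<in> R" "g \<in> R" for f g
    proof -
      have "(\<lambda>x\<in>M. (\<lambda>x\<in>M. complex_of_real (f x)) x * (\<lambda>x\<in>M. complex_of_real (g x)) x) \<in> A"
        using that unfolding R_def A_def mem_Collect_eq by (rule generated_algebra.mult)
      then show ?thesis unfolding R_def A_def by (auto elim!: generated_algebra_cong)
    qed
    show "(\<lambda>_. c) \<in> R" for c
      unfolding R_def A_def H_def by (auto intro!: generated_algebra.generator)
    show "\<exists>f\<in>R. f x \<noteq> f y" if xy: "x \<in> M" "y \<in> M" "x \<noteq> y" for x y
    proof -
      obtain g where g: "g \<in> G" "g x \<noteq> g y" using sep xy by blast
      then have gA: "restrict g M \<in> A"
        unfolding A_def H_def by (auto intro: generated_algebra.generator)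
      have "Re (g x) \<noteq> Re (g y) \<or> Im (g x) \<noteq> Im (g y)"
        using g(2) by (simp add: complex_eq_iff)
      then show ?thesis
      proof
        assume "Re (g x) \<noteq> Re (g y)"
        then show ?thesis using xy by (intro bexI[OF _ Re[OF gA]]) simp
      next
        assume "Im (g x) \<noteq> Im (g y)"
        then show ?thesis using xy by (intro bexI[OF _ Im[OF gA]]) simp
      qed
    qed
  qed
  have "\<exists>g\<in>A. \<forall>x\<in>M. cmod (f x - g x) < r" if f: "f \<in> mspace (CC M)" and r: "r > 0" for f r
  proof -
    have "continuous_on M f" using f M by (simp add: mspace_CC)
    \<comment> \<open>The errors \<open>r/2\<close> add up, since a modulus is at most the sum of
      the absolute values of the real and imaginary parts.\<close>
    then obtain u v where u: "u \<in> R" "\<forall>x\<in>M. \<bar>Re (f x) - u x\<bar> < r/2"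
      and v: "v \<in> R" "\<forall>x\<in>M. \<bar>Im (f x) - v x\<bar> < r/2"
      using Stone_Weierstrass_basic[of "\<lambda>x. Re (f x)" "r/2"]
        Stone_Weierstrass_basic[of "\<lambda>x. Im (f x)" "r/2"] r
      by (metis continuous_on_Re continuous_on_Im half_gt_zero)
    define g where "g = (\<lambda>x\<in>M. (\<lambda>x\<in>M. complex_of_real (u x)) x
       + (\<lambda>x\<in>M. \<i> * (\<lambda>x\<in>M. complex_of_real (v x)) x) x)"
    have "g \<in> A"
      unfolding g_def using u(1) v(1) unfolding A_def R_def mem_Collect_eq
      by (intro generated_algebra.add[OF _ generated_algebra.scale])
    moreover have "cmod (f x - g x) < r" if "x \<in> M" for x
      using cmod_le[of "f x - g x"] u(2) v(2) that by (fastforce simp: g_def)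
    ultimately show ?thesis by blast
  qed
  then show ?thesis
    using uniform_closure_eq[OF M A] by (auto simp: A_def H_def)
qed

lemma Stone_Weierstrass_complex_vanishing:
  fixes M :: "'a::t2_space set"
  assumes M: "compact M" and p: "p \<in> M" and cont: "\<And>g. g \<in> G \<Longrightarrow> continuous_on M g"
    and cnj: "\<And>g. g \<in> G \<Longrightarrow> \<exists>h\<in>G. \<forall>x\<in>M. h x = cnj (g x)"
    and sep: "\<And>x y. \<lbrakk>x \<in> M; y \<in> M; x \<noteq> y\<rbrakk> \<Longrightarrow> \<exists>g\<in>G. g x \<noteq> g y"
    and vanish: "\<And>g. g \<in> G \<Longrightarrow> g p = 0"
  shows "uniform_closure M (generated_algebra M G) = vanishing_ideal M p"
proof -
  define H where "H = G \<union> {\<lambda>x. c | c. True}"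
  have AH: "generated_algebra M H \<subseteq> mspace (CC M)"
    by (rule generated_algebra_subset_CC[OF M]) (auto simp: H_def cont)
  have A: "generated_algebra M G \<subseteq> mspace (CC M)"
    by (rule generated_algebra_subset_CC[OF M cont])
  have v: "h p = 0" if "h \<in> generated_algebra M G" for h
    using that by induction (auto simp: vanish p)
  have "f p = 0"
    if approx: "\<forall>r>0. \<exists>g\<in>generated_algebra M G. \<forall>x\<in>M. cmod (f x - g x) < r" for f
  proof (rule ccontr)
    assume "f p \<noteq> 0"
    \<comment> \<open>Every member of the algebra is 0 at \<open>p\<close>, so its error there
      equals \<open>cmod (f p)\<close>, and this tolerance cannot be met strictly.\<close>
    then obtain g where "g \<in> generated_algebra M G" "cmod (f p - g p) < cmod (f p)"
      using approx[rule_format, of "cmod (f p)"] p by auto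
    then show False using v[of g] by simp
  qed
  moreover have "\<exists>g\<in>generated_algebra M G. \<forall>x\<in>M. cmod (f x - g x) < r"
    if f: "f \<in> mspace (CC M)" "f p = 0" and r: "r > 0" for f r
  proof -
    have "f \<in> uniform_closure M (generated_algebra M H)"
      unfolding H_def using Stone_Weierstrass_complex[OF M cont cnj sep] f(1) by blast
    \<comment> \<open>Half of the tolerance is reserved for dropping the constant term.\<close>
    then obtain g where g: "g \<in> generated_algebra M H" "\<forall>x\<in>M. cmod (f x - g x) < r/2"
      unfolding uniform_closure_eq[OF M AH] using r half_gt_zero by blast
    then obtain h c where h: "h \<in> generated_algebra M G" "g = (\<lambda>x\<in>M. h x + c)"
      using generated_algebra_append_constants unfolding H_def by blast
    have c: "cmod c < r/2"
      using g(2) p f(2) v[OF h(1)] by (auto simp: h(2) dest!: bspec[OF _ p])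
    have "cmod (f x - h x) < r" if "x \<in> M" for x
    proof -
      have "cmod (f x - h x) \<le> cmod (f x - g x) + cmod c"
        using norm_triangle_ineq[of "f x - g x" c] that by (simp add: h(2))
      then show ?thesis using g(2) that c by fastforce
    qed
    then show ?thesis using h(1) by blast
  qed
  ultimately show ?thesis
    unfolding uniform_closure_eq[OF M A] vanishing_ideal_def by blast
qed

section \<open>Transport along the conjugacy\<close>

text \<open>Composition with the inverse of \<open>\<tau>\<close> respects all algebra operations,
  and each inclusion is an induction over the generated algebra. Approximation can thus be carried
  out on the image with the composed generators.\<close>

lemma transport_generated_algebra:
  assumes "inj_on \<tau> U" "K \<subseteq> U"
  shows "transport U \<tau> K (generated_algebra K G) =
    generated_algebra (\<tau> ` K) ((\<lambda>g. g \<circ> inv_into U \<tau>) ` G)"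
proof -
  define s where "s = inv_into U \<tau>"
  define P where "P f = restrict (f \<circ> s) (\<tau> ` K)" for f :: "'a \<Rightarrow> complex"
  define G' where "G' = (\<lambda>g. g \<circ> s) ` G"
  have s: "s (\<tau> x) = x" if "x \<in> K" for x
    using assms that by (auto simp: s_def)
  \<comment> \<open>The inverse maps the image of \<open>K\<close> back into \<open>K\<close>, where
    the inner restriction is invisible.\<close>
  have P: "P (\<lambda>x\<in>K. f x) = (\<lambda>y\<in>\<tau> ` K. f (s y))" for f
    by (rule ext) (auto simp: P_def s)
  have "P f \<in> generated_algebra (\<tau> ` K) G'" if "f \<in> generated_algebra K G" for f
    using that
  proof induction
    case (generator g)
    have "restrict (g \<circ> s) (\<tau> ` K) \<in> generated_algebra (\<tau> ` K) G'"
      using generator by (intro generated_algebra.generator) (auto simp: G'_def)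
    then show ?case by (simp only: P comp_def)
  next
    case zero
    then show ?case unfolding P by (rule generated_algebra.zero)
  next
    case (add f g)
    show ?case unfolding P
      by (rule generated_algebra_cong[OF generated_algebra.add[OF add.IH]]) (simp add: P_def)
  next
    case (scale f c)
    show ?case unfolding P
      by (rule generated_algebra_cong[OF generated_algebra.scale[OF scale.IH, of c]]) (simp add: P_def)
  next
    case (mult f g)
    show ?case unfolding P
      by (rule generated_algebra_cong[OF generated_algebra.mult[OF mult.IH]]) (simp add: P_def)
  qed
  moreover have "f \<in> P ` generated_algebra K G" if "f \<in> generated_algebra (\<tau> ` K) G'" for f
    using that
  proof induction
    case (generator g)
    then obtain h where h: "h \<in> G" "g = h \<circ> s" by (auto simp: G'_def)
    show ?case
      by (rule image_eqI[OF _ generated_algebra.generator[OF h(1)]]) (simp only: P h comp_def)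
  next
    case zero
    show ?case by (rule image_eqI[OF _ generated_algebra.zero]) (simp only: P)
  next
    case (add f g)
    then obtain f' g' where *: "f' \<in> generated_algebra K G" "f = P f'"
      "g' \<in> generated_algebra K G" "g = P g'" by blast
    show ?case
      by (rule image_eqI[OF _ generated_algebra.add[OF *(1,3)]])
        (unfold P *(2,4), rule restrict_ext, simp add: P_def)
  next
    case (scale f c)
    then obtain f' where *: "f' \<in> generated_algebra K G" "f = P f'" by blast
    show ?case
      by (rule image_eqI[OF _ generated_algebra.scale[OF *(1), of c]])
        (unfold P *(2), rule restrict_ext, simp add: P_def)
  next
    case (mult f g)
    then obtain f' g' where *: "f' \<in> generated_algebra K G" "f = P f'"
      "g' \<in> generated_algebra K G" "g = P g'" by blast
    show ?case
      by (rule image_eqI[OF _ generated_algebra.mult[OF *(1,3)]])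
        (unfold P *(2,4), rule restrict_ext, simp add: P_def)
  qed
  ultimately show ?thesis
    unfolding transport_def P_def[abs_def] G'_def s_def by blast
qed

section \<open>The ring of continuous functions and its maximal ideals\<close>

lemma CC_ring_simps:
  assumes "compact M"
  shows "f \<in> carrier (CC_ring M) \<longleftrightarrow> continuous_on M f \<and> f \<in> extensional M"
    and "f \<oplus>\<^bsub>CC_ring M\<^esub> g = (\<lambda>x\<in>M. f x + g x)"
    and "f \<otimes>\<^bsub>CC_ring M\<^esub> g = (\<lambda>x\<in>M. f x * g x)"
    and "\<zero>\<^bsub>CC_ring M\<^esub> = (\<lambda>x\<in>M. 0)"
    and "\<one>\<^bsub>CC_ring M\<^esub> = (\<lambda>x\<in>M. 1)"
  by (simp_all add: CC_ring_def mspace_CC assms)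

lemma cring_CC_ring:
  assumes M: "compact M"
  shows "cring (CC_ring M)"
proof (rule cringI)
  show "abelian_group (CC_ring M)"
  proof (rule abelian_groupI)
    fix f g h
    assume f: "f \<in> carrier (CC_ring M)" and g: "g \<in> carrier (CC_ring M)"
      and h: "h \<in> carrier (CC_ring M)"
    show "f \<oplus>\<^bsub>CC_ring M\<^esub> g \<in> carrier (CC_ring M)"
      using f g by (simp add: CC_ring_simps[OF M] continuous_on_add)
    show "f \<oplus>\<^bsub>CC_ring M\<^esub> g \<oplus>\<^bsub>CC_ring M\<^esub> h = f \<oplus>\<^bsub>CC_ring M\<^esub> (g \<oplus>\<^bsub>CC_ring M\<^esub> h)"
      unfolding CC_ring_simps[OF M] by (rule restrict_ext) simp
    show "f \<oplus>\<^bsub>CC_ring M\<^esub> g = g \<oplus>\<^bsub>CC_ring M\<^esub> f"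
      unfolding CC_ring_simps[OF M] by (rule restrict_ext) simp
  next
    show "\<zero>\<^bsub>CC_ring M\<^esub> \<in> carrier (CC_ring M)"
      by (simp add: CC_ring_simps[OF M])
  next
    fix f assume f: "f \<in> carrier (CC_ring M)"
    then show "\<zero>\<^bsub>CC_ring M\<^esub> \<oplus>\<^bsub>CC_ring M\<^esub> f = f"
      \<comment> \<open>The sum is restricted to \<open>M\<close>, so it equals \<open>f\<close>
        because \<open>f\<close> is itself extensional.\<close>
      unfolding CC_ring_simps[OF M] by (intro extensionalityI[of _ M]) auto
    have "(\<lambda>x\<in>M. - f x) \<oplus>\<^bsub>CC_ring M\<^esub> f = \<zero>\<^bsub>CC_ring M\<^esub>"
      unfolding CC_ring_simps[OF M] by (rule restrict_ext) simp
    moreover have "(\<lambda>x\<in>M. - f x) \<in> carrier (CC_ring M)"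
      using f by (simp add: CC_ring_simps[OF M] continuous_on_minus)
    ultimately show "\<exists>g\<in>carrier (CC_ring M). g \<oplus>\<^bsub>CC_ring M\<^esub> f = \<zero>\<^bsub>CC_ring M\<^esub>" by blast
  qed
  show "comm_monoid (CC_ring M)"
  proof (rule comm_monoidI)
    fix f g h
    assume f: "f \<in> carrier (CC_ring M)" and g: "g \<in> carrier (CC_ring M)"
      and h: "h \<in> carrier (CC_ring M)"
    show "f \<otimes>\<^bsub>CC_ring M\<^esub> g \<in> carrier (CC_ring M)"
      using f g by (simp add: CC_ring_simps[OF M] continuous_on_mult)
    show "f \<otimes>\<^bsub>CC_ring M\<^esub> g \<otimes>\<^bsub>CC_ring M\<^esub> h = f \<otimes>\<^bsub>CC_ring M\<^esub> (g \<otimes>\<^bsub>CC_ring M\<^esub> h)"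
      unfolding CC_ring_simps[OF M] by (rule restrict_ext) simp
    show "f \<otimes>\<^bsub>CC_ring M\<^esub> g = g \<otimes>\<^bsub>CC_ring M\<^esub> f"
      unfolding CC_ring_simps[OF M] by (rule restrict_ext) simp
  next
    show "\<one>\<^bsub>CC_ring M\<^esub> \<in> carrier (CC_ring M)"
      by (simp add: CC_ring_simps[OF M])
  next
    fix f assume "f \<in> carrier (CC_ring M)"
    then show "\<one>\<^bsub>CC_ring M\<^esub> \<otimes>\<^bsub>CC_ring M\<^esub> f = f"
      unfolding CC_ring_simps[OF M] by (intro extensionalityI[of _ M]) auto
  qed
next
  fix f g h
  show "(f \<oplus>\<^bsub>CC_ring M\<^esub> g) \<otimes>\<^bsub>CC_ring M\<^esub> h = f \<otimes>\<^bsub>CC_ring M\<^esub> h \<oplus>\<^bsub>CC_ring M\<^esub> g \<otimes>\<^bsub>CC_ring M\<^esub> h"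
    unfolding CC_ring_simps[OF M] by (rule restrict_ext) (simp add: algebra_simps)
qed

text \<open>If an ideal above it contains \<open>f\<close> with \<open>f p \<noteq> 0\<close>, then
  1 is the sum of \<open>f / f p\<close>, a multiple of \<open>f\<close>, and
  \<open>1 - f / f p\<close>, which vanishes at \<open>p\<close>.\<close>

lemma maximalideal_vanishing_ideal:
  assumes M: "compact M" and p: "p \<in> M"
  shows "maximalideal (vanishing_ideal M p) (CC_ring M)"
proof (rule maximalidealI)
  interpret cring "CC_ring M" by (rule cring_CC_ring[OF M])
  have one: "\<one>\<^bsub>CC_ring M\<^esub> \<notin> vanishing_ideal M p"
    using p by (simp add: CC_ring_def vanishing_ideal_def)
  then show "carrier (CC_ring M) \<noteq> vanishing_ideal M p"
    using one_closed by blast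
  show "ideal (vanishing_ideal M p) (CC_ring M)"
  proof (rule idealI[OF ring_axioms])
    show "subgroup (vanishing_ideal M p) (add_monoid (CC_ring M))"
    proof (rule add.subgroupI)
      show "vanishing_ideal M p \<subseteq> carrier (CC_ring M)"
        by (auto simp: vanishing_ideal_def CC_ring_def)
      show "vanishing_ideal M p \<noteq> {}"
        using zero_closed p by (auto simp: vanishing_ideal_def CC_ring_def)
      show "\<ominus>\<^bsub>CC_ring M\<^esub> f \<in> vanishing_ideal M p" if "f \<in> vanishing_ideal M p" for f
      proof -
        have f: "f \<in> carrier (CC_ring M)" "f p = 0"
          using that by (auto simp: vanishing_ideal_def CC_ring_def)
        \<comment> \<open>The additive inverse is known only abstractly; its value at
          \<open>p\<close> is read off from the equation that characterizes it.\<close>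
        have "(f \<oplus>\<^bsub>CC_ring M\<^esub> \<ominus>\<^bsub>CC_ring M\<^esub> f) p = \<zero>\<^bsub>CC_ring M\<^esub> p"
          using r_neg[OF f(1)] by simp
        then have "(\<ominus>\<^bsub>CC_ring M\<^esub> f) p = 0"
          using f(2) p by (simp add: CC_ring_def)
        then show ?thesis
          using a_inv_closed[OF f(1)] by (simp add: vanishing_ideal_def CC_ring_def)
      qed
    qed (use p in \<open>auto simp: vanishing_ideal_def CC_ring_def mspace_CC M intro!: continuous_intros\<close>)
  qed (use p in \<open>auto simp: vanishing_ideal_def CC_ring_def mspace_CC M intro!: continuous_intros\<close>)
  fix J assume J: "ideal J (CC_ring M)" "vanishing_ideal M p \<subseteq> J" "J \<subseteq> carrier (CC_ring M)"
  interpret J: ideal J "CC_ring M" by fact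
  show "J = vanishing_ideal M p \<or> J = carrier (CC_ring M)"
  proof (cases "J \<subseteq> vanishing_ideal M p")
    case False
    then obtain f where f: "f \<in> J" "f p \<noteq> 0" "f \<in> mspace (CC M)"
      using J(3) by (auto simp: vanishing_ideal_def CC_ring_def)
    define u where "u = (\<lambda>x\<in>M. inverse (f p) * f x)"
    define w where "w = (\<lambda>x\<in>M. 1 - inverse (f p) * f x)"
    have "(\<lambda>x\<in>M. inverse (f p)) \<in> carrier (CC_ring M)"
      by (auto simp: CC_ring_def mspace_CC M)
    from J.I_l_closed[OF f(1) this] have "u \<in> J"
      by (simp add: u_def CC_ring_def cong: restrict_cong)
    moreover have "w \<in> J"
      using f p J(2) by (auto simp: w_def vanishing_ideal_def mspace_CC M intro!: continuous_intros)
    ultimately have "u \<oplus>\<^bsub>CC_ring M\<^esub> w \<in> J" by simp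
    moreover have "u \<oplus>\<^bsub>CC_ring M\<^esub> w = \<one>\<^bsub>CC_ring M\<^esub>"
      by (auto simp: CC_ring_def u_def w_def)
    ultimately show ?thesis using J.one_imp_carrier by simp
  qed (use J in blast)
qed

section \<open>Principle eigenfunctions on the real space\<close>

text \<open>A real vector is its own conjugate, so the two alternatives of the definition
  merge.\<close>

lemma conj_eigenbasis_conjugate:
  assumes "conj_eigenbasis F n e" "k \<in> {1..n}"
  obtains j where "j \<in> {1..n}" "e j = conjugate (e k)"
  using assms unfolding conj_eigenbasis_def
  by (metis conjugate_def minus_zero prod.collapse)

text \<open>Conjugating both argument and value of \<open>\<phi> k\<close> gives a complex-linear
  functional again. It agrees with \<open>\<phi> j\<close> on the basis when \<open>e j\<close> is
  the conjugate of \<open>e k\<close>, hence everywhere; on real vectors the inner conjugation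
  disappears.\<close>

lemma dual_basis_cnj:
  assumes E: "conj_eigenbasis F n e" and D: "dual_basis n e \<phi>" and k: "k \<in> {1..n}"
  obtains j where "j \<in> {1..n}" "\<And>x. \<phi> j (x, 0) = cnj (\<phi> k (x, 0))"
proof -
  obtain j where j: "j \<in> {1..n}" "e j = conjugate (e k)"
    using conj_eigenbasis_conjugate[OF E k] .
  have conj2: "conjugate (conjugate v) = v" for v :: "'a complexification"
    by (simp add: conjugate_def)
  have lin: "Vector_Spaces.linear cscale (*) (\<phi> i)" if "i \<in> {1..n}" for i
    using D that by (auto simp: dual_basis_def)
  interpret k: Vector_Spaces.linear cscale "(*)" "\<phi> k" by (rule lin[OF k])
  define \<psi> where "\<psi> v = cnj (\<phi> k (conjugate v))" for v
  have cs: "conjugate (cscale c v) = cscale (cnj c) (conjugate v)"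
    "conjugate (v + w) = conjugate v + conjugate w" for c and v w :: "'a complexification"
    by (auto simp: conjugate_def cscale_def)
  have \<psi>: "Vector_Spaces.linear cscale (*) \<psi>"
    by unfold_locales (auto simp: \<psi>_def cs k.add k.scale algebra_simps)
  have "\<phi> j v = \<psi> v" for v
  proof (rule vector_space_pair.linear_eq_on[OF _ lin[OF j(1)] \<psi>])
    show "vector_space_pair (cscale :: _ \<Rightarrow> 'a complexification \<Rightarrow> _) ((*) :: complex \<Rightarrow> _)"
      by unfold_locales (auto simp: algebra_simps)
    show "v \<in> cx.span (e ` {1..n})"
      using E by (simp add: conj_eigenbasis_def)
    fix b assume "b \<in> e ` {1..n}"
    then obtain i where i: "i \<in> {1..n}" "b = e i" by blast
    obtain i' where i': "i' \<in> {1..n}" "e i' = conjugate (e i)"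
      using conj_eigenbasis_conjugate[OF E i(1)] .
    \<comment> \<open>Conjugation permutes the basis as an involution, so the Kronecker deltas of
      both functionals at \<open>e i\<close> coincide.\<close>
    have "i = j \<longleftrightarrow> i' = k"
    proof -
      have inj: "inj_on e {1..n}"
        using E by (simp add: conj_eigenbasis_def)
      have "i = j \<longleftrightarrow> e i = conjugate (e k)"
        using inj_on_eq_iff[OF inj i(1) j(1)] j(2) by simp
      also have "\<dots> \<longleftrightarrow> conjugate (e i) = e k"
        using conj2 by metis
      also have "\<dots> \<longleftrightarrow> i' = k"
        using inj_on_eq_iff[OF inj i'(1) k] i'(2) by simp
      finally show ?thesis .
    qed
    then show "\<phi> j b = \<psi> b"
      using D i i' j k by (auto simp: dual_basis_def \<psi>_def simp flip: i'(2))
  qed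
  have "\<phi> j (x, 0) = cnj (\<phi> k (x, 0))" for x
    using \<open>\<And>v. \<phi> j v = \<psi> v\<close> by (simp add: \<psi>_def conjugate_def)
  then show thesis using that j(1) by blast
qed

text \<open>The functionals read off the coefficients of \<open>v - w\<close> in the basis, so all
  of these vanish.\<close>

lemma dual_basis_separates:
  assumes E: "conj_eigenbasis F n e" and D: "dual_basis n e \<phi>"
    and eq: "\<And>k. k \<in> {1..n} \<Longrightarrow> \<phi> k v = \<phi> k w"
  shows "v = w"
proof -
  have inj: "inj_on e {1..n}" and span: "cx.span (e ` {1..n}) = UNIV"
    using E by (auto simp: conj_eigenbasis_def)
  obtain c where "v - w = (\<Sum>b\<in>e ` {1..n}. cscale (c b) b)"
    using span unfolding cx.span_finite[OF finite_imageI[OF finite_atLeastAtMost]] by blast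
  then have c: "v - w = (\<Sum>i\<in>{1..n}. cscale (c (e i)) (e i))"
    by (simp only: sum.reindex[OF inj] comp_def)
  have "c (e k) = 0" if k: "k \<in> {1..n}" for k
  proof -
    interpret k: Vector_Spaces.linear cscale "(*)" "\<phi> k"
      using D k by (auto simp: dual_basis_def)
    have "0 = \<phi> k (v - w)"
      using eq[OF k] by (simp add: k.diff)
    also have "\<dots> = (\<Sum>i\<in>{1..n}. c (e i) * (if i = k then 1 else 0))"
      unfolding c k.sum k.scale using D k by (intro sum.cong) (auto simp: dual_basis_def)
    also have "\<dots> = c (e k)"
      using k by (simp add: mult_delta_right)
    finally show ?thesis by simp
  qed
  then have "v - w = 0"
    unfolding c by (intro sum.neutral) (auto simp: cscale_def zero_prod_def)
  then show ?thesis by simp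
qed

text \<open>A real scalar acts on \<open>(x, 0)\<close> as in the real space, so the restriction to
  real vectors is real-linear, hence bounded in finite dimension.\<close>

lemma continuous_dual_basis:
  fixes \<phi> :: "nat \<Rightarrow> 'a::real_normed_vector complexification \<Rightarrow> complex"
  assumes "\<exists>B::'a set. finite B \<and> span B = UNIV" "dual_basis n e \<phi>" "k \<in> {1..n}"
  shows "continuous_on S (\<lambda>x. \<phi> k (x, 0))"
proof -
  interpret k: Vector_Spaces.linear cscale "(*)" "\<phi> k"
    using assms by (auto simp: dual_basis_def)
  have "linear (\<lambda>x. \<phi> k (x, 0))"
  proof
    show "\<phi> k (x + y, 0) = \<phi> k (x, 0) + \<phi> k (y, 0)" for x y
      using k.add[of "(x, 0)" "(y, 0)"] by simp
    show "\<phi> k (r *\<^sub>R x, 0) = r *\<^sub>R \<phi> k (x, 0)" for r x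
      using k.scale[of "complex_of_real r" "(x, 0)"] by (simp add: cscale_def scaleR_conv_of_real)
  qed
  then show ?thesis
    using assms(1) linear_finite_dim_imp_bounded_linear linear_continuous_on by blast
qed

section \<open>Closures of the transported principle algebra\<close>

theorem mainTheorem2:
  fixes T \<tau> :: "'a::banach \<Rightarrow> 'a"
    and U V K L :: "'a set"
    and n :: nat
    and e :: "nat \<Rightarrow> 'a complexification"
    and \<phi> :: "nat \<Rightarrow> 'a complexification \<Rightarrow> complex"
    and A\<^sub>K :: "('a \<Rightarrow> complex) set"
  assumes "\<exists>B::'a set. finite B \<and> span B = UNIV"
    and "n = dim (UNIV :: 'a set)"
    and "polynomial_function T" and "diffeomorphism T"
    and "asymptotically_stable_fixed_point T 0"
    and "hyperbolic_fixed_point T 0"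
    and "diagonalizable (complexify (frechet_derivative T (at 0)))"
    and "0 \<in> interior U" and "0 \<in> interior V"
    and "topological_conjugacy U V \<tau> (frechet_derivative T (at 0)) T"
    and "\<tau> 0 = 0"
    and "compact K" and "0 \<in> interior K" and "K \<subseteq> U"
    and "L = \<tau> ` K"
    and "conj_eigenbasis (complexify (frechet_derivative T (at 0))) n e"
    and "dual_basis n e \<phi>"
    and "A\<^sub>K = principle_algebra n \<phi> K"
  shows "uniform_closure L (transport U \<tau> K (append_constants K A\<^sub>K)) = mspace (CC L) \<and>
         uniform_closure L (transport U \<tau> K A\<^sub>K) = vanishing_ideal L 0 \<and>
         maximalideal (vanishing_ideal L 0) (CC_ring L)"
proof -
  define s where "s = inv_into U \<tau>"
  define \<Phi> where "\<Phi> = (\<lambda>k x. \<phi> k (x, 0)) ` {1..n}"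
  have A\<^sub>K: "A\<^sub>K = generated_algebra K \<Phi>"
    using assms by (simp add: principle_algebra_def \<Phi>_def)
  have hom: "homeomorphism U V \<tau> s"
    using assms by (simp add: topological_conjugacy_def s_def)
  then have s\<tau>: "s (\<tau> x) = x" if "x \<in> U" for x
    using that by (simp add: homeomorphism_def)
  have inj: "inj_on \<tau> U"
    using s\<tau> by (metis inj_onI)
  have "K \<subseteq> U" "L = \<tau> ` K" "compact K" by fact+
  have L: "compact L"
    unfolding \<open>L = \<tau> ` K\<close> using \<open>compact K\<close> \<open>K \<subseteq> U\<close> hom
    by (auto simp: homeomorphism_def intro!: compact_continuous_image elim: continuous_on_subset)
  have conts: "continuous_on L s"
    using hom \<open>K \<subseteq> U\<close> unfolding \<open>L = \<tau> ` K\<close> homeomorphism_def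
    by (metis continuous_on_subset image_mono)
  have sL: "s y \<in> K" "\<tau> (s y) = y" if "y \<in> L" for y
    using that s\<tau> \<open>K \<subseteq> U\<close> by (auto simp: \<open>L = \<tau> ` K\<close>)
  have "0 \<in> K"
    using \<open>0 \<in> interior K\<close> interior_subset by blast
  then have s0: "s 0 = 0" and L0: "0 \<in> L"
    using s\<tau>[of 0] \<open>\<tau> 0 = 0\<close> \<open>K \<subseteq> U\<close> by (auto simp: \<open>L = \<tau> ` K\<close> image_iff)

  have \<Phi>_cont: "continuous_on S g" if "g \<in> \<Phi>" for S g
    using that continuous_dual_basis[OF assms(1) \<open>dual_basis n e \<phi>\<close>] by (auto simp: \<Phi>_def)
  \<comment> \<open>The set \<open>S\<close> stays free: the composed generators use the whole
    space, the conjugates inside \<open>A\<^sub>K\<close> use \<open>K\<close>.\<close>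
  have \<Phi>_cnj: "\<exists>h\<in>\<Phi>. \<forall>x\<in>S. h x = cnj (g x)" if g: "g \<in> \<Phi>" for S g
  proof -
    obtain k where k: "k \<in> {1..n}" "g = (\<lambda>x. \<phi> k (x, 0))"
      using g unfolding \<Phi>_def by blast
    obtain j where "j \<in> {1..n}" "\<And>x. \<phi> j (x, 0) = cnj (\<phi> k (x, 0))"
      using dual_basis_cnj[OF assms(16,17) k(1)] by blast
    then show ?thesis
      unfolding \<Phi>_def k by fastforce
  qed
  have \<Phi>_sep: "\<exists>g\<in>\<Phi>. g x \<noteq> g y" if "x \<noteq> y" for x y
    using that dual_basis_separates[OF assms(16,17), of "(x, 0)" "(y, 0)"]
    unfolding \<Phi>_def by (metis Pair_inject image_eqI)
  have \<Phi>_0: "g 0 = 0" if g: "g \<in> \<Phi>" for g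
  proof -
    obtain k where k: "k \<in> {1..n}" "g = (\<lambda>x. \<phi> k (x, 0))"
      using g unfolding \<Phi>_def by blast
    interpret k: Vector_Spaces.linear cscale "(*)" "\<phi> k"
      using k assms(17) by (auto simp: dual_basis_def)
    show ?thesis using k.zero by (simp add: k zero_prod_def)
  qed

  have "uniform_closure L (generated_algebra L ((\<lambda>g. g \<circ> s) ` \<Phi>)) = vanishing_ideal L 0"
  proof (rule Stone_Weierstrass_complex_vanishing[OF L L0])
    show "continuous_on L g" if "g \<in> (\<lambda>g. g \<circ> s) ` \<Phi>" for g
      using that \<Phi>_cont conts by (auto intro!: continuous_on_compose)
    show "\<exists>h\<in>(\<lambda>g. g \<circ> s) ` \<Phi>. \<forall>x\<in>L. h x = cnj (g x)" if "g \<in> (\<lambda>g. g \<circ> s) ` \<Phi>" for g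
    proof -
      obtain f where f: "f \<in> \<Phi>" "g = f \<circ> s" using \<open>g \<in> (\<lambda>g. g \<circ> s) ` \<Phi>\<close> by blast
      obtain h where "h \<in> \<Phi>" "\<forall>x\<in>UNIV. h x = cnj (f x)" using \<Phi>_cnj[OF f(1)] by blast
      then show ?thesis by (intro bexI[of _ "h \<circ> s"]) (simp_all add: f(2))
    qed
    show "\<exists>g\<in>(\<lambda>g. g \<circ> s) ` \<Phi>. g x \<noteq> g y" if "x \<in> L" "y \<in> L" "x \<noteq> y" for x y
      using \<Phi>_sep[of "s x" "s y"] sL that by (metis comp_apply image_eqI)
    show "g 0 = 0" if "g \<in> (\<lambda>g. g \<circ> s) ` \<Phi>" for g
      using that \<Phi>_0 s0 by auto
  qed
  then have b: "uniform_closure L (transport U \<tau> K A\<^sub>K) = vanishing_ideal L 0"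
    using transport_generated_algebra[OF inj \<open>K \<subseteq> U\<close>] by (simp add: A\<^sub>K \<open>L = \<tau> ` K\<close> s_def)

  \<comment> \<open>\<open>append_constants\<close> generates from all of \<open>A\<^sub>K\<close>,
    so continuity, conjugation and separation are now required of its members rather than of
    \<open>\<Phi>\<close>.\<close>
  define G where "G = (\<lambda>g. g \<circ> s) ` A\<^sub>K"
  have "uniform_closure L (generated_algebra L (G \<union> {\<lambda>x. c | c. True})) = mspace (CC L)"
  proof (rule Stone_Weierstrass_complex[OF L])
    have "A\<^sub>K \<subseteq> mspace (CC K)"
      unfolding A\<^sub>K by (intro generated_algebra_subset_CC \<open>compact K\<close> \<Phi>_cont)
    then show "continuous_on L g" if "g \<in> G" for g
      using that conts sL(1) mspace_CC[OF \<open>compact K\<close>]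
      by (auto simp: G_def intro!: continuous_on_compose intro: continuous_on_subset)
    show "\<exists>h\<in>G. \<forall>x\<in>L. h x = cnj (g x)" if "g \<in> G" for g
    proof -
      obtain f where f: "f \<in> A\<^sub>K" "g = f \<circ> s" using \<open>g \<in> G\<close> by (auto simp: G_def)
      then have "(\<lambda>x\<in>K. cnj (f x)) \<in> A\<^sub>K"
        unfolding A\<^sub>K using generated_algebra_cnj[OF \<Phi>_cnj] by blast
      then show ?thesis
        by (intro bexI[of _ "(\<lambda>x\<in>K. cnj (f x)) \<circ> s"]) (auto simp: G_def f sL)
    qed
    show "\<exists>g\<in>G. g x \<noteq> g y" if xy: "x \<in> L" "y \<in> L" "x \<noteq> y" for x y
    proof -
      obtain g where g: "g \<in> \<Phi>" "g (s x) \<noteq> g (s y)"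
        using \<Phi>_sep[of "s x" "s y"] sL xy by metis
      \<comment> \<open>Members of \<open>A\<^sub>K\<close> are extensional, hence the restriction;
        it changes no value on \<open>L\<close>, since \<open>s\<close> maps \<open>L\<close> into
        \<open>K\<close>.\<close>
      then have "restrict g K \<circ> s \<in> G"
        unfolding G_def A\<^sub>K by (intro imageI generated_algebra.generator)
      then show ?thesis
        using g sL xy by (intro bexI[of _ "restrict g K \<circ> s"]) auto
    qed
  qed
  \<comment> \<open>Composition with \<open>s\<close> fixes the constants, so transport and
    appending constants commute on the level of generators.\<close>
  moreover have "(\<lambda>g. g \<circ> s) ` (A\<^sub>K \<union> {\<lambda>x. c | c. True}) = G \<union> {\<lambda>x. c | c. True}"
    by (auto simp: G_def image_Un comp_def image_iff)
  ultimately have a: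
    "uniform_closure L (transport U \<tau> K (append_constants K A\<^sub>K)) = mspace (CC L)"
    using transport_generated_algebra[OF inj \<open>K \<subseteq> U\<close>]
    by (simp add: append_constants_def \<open>L = \<tau> ` K\<close> s_def)
  show ?thesis
    using a b maximalideal_vanishing_ideal[OF L L0] by blast
qed

end
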